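(* Let $H_1,H_2$ be infinite-dimensional complex Hilbert spaces, let $T:D(T)\subseteq H_1\to H_2$ be a densely defined closed linear operator whose range $R(T)$ is closed, and let $S:H_1\to H_2$ be a bounded linear operator satisfying: (1) $\|T^\dagger S\|<1$, (2) $TT^\dagger S=S$, and (3) $ST^\dagger T=S|_{D(T)}$. Then: (a) $R(T+S)$ is closed; and (b) $(T+S)^\dagger=(I+T^\dagger S)^{-1}T^\dagger=T^\dagger(I+ST^\dagger)^{-1}$. Hence $T^\dagger=(T+S)^\dagger(I+ST^\dagger)$.
   Context: $D(\cdot)$, $N(\cdot)$, $R(\cdot)$ denote the domain, null space and range of an operator, and $I$ denotes the identity operator on the relevant space. The sum $T+S$ has domain $D(T+S)=D(T)$. For a densely defined closed operator $T:D(T)\subseteq H_1\to H_2$, the Moore-Penrose inverse $T^\dagger$ is the unique densely defined closed operator from $H_2$ to $H_1$ with domain $D(T^\dagger)=R(T)\oplus^\perp R(T)^\perp$ such that $TT^\dagger y=P_{\overline{R(T)}}\,y$ for all $y\in D(T^\dagger)$, $T^\dagger Tx=P_{N(T)^\perp}x$ for all $x\in D(T)$, and $N(T^\dagger)=R(T)^\perp$; here $P_M$ is the orthogonal projection onto the closed subspace $M$. When $R(T)$ is closed, $T^\dagger$ is bounded and defined on all of $H_2$. *)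

theory Defs
  imports "HOL-Analysis.Analysis"
begin

section \<open>Complex Hilbert spaces\<close>

text \<open>
  A complex inner product space is a complex vector space whose underlying real inner product
  space (hence norm and topology) is the one induced by the complex inner product: the real
  scalar multiplication is the restriction of the complex one, and \<open>inner\<close> is the real part
  of \<open>cinner\<close>, so that \<open>norm x = sqrt (Re (cinner x x))\<close>. The inner product is linear in its
  first argument. Positive definiteness follows from that of \<open>inner\<close>, as \<open>cinner x x\<close> is real.
\<close>

class complex_inner = real_inner +
  fixes scaleC :: "complex \<Rightarrow> 'a \<Rightarrow> 'a"  (infixr "*\<^sub>C" 75)
    and cinner :: "'a \<Rightarrow> 'a \<Rightarrow> complex"
  assumes scaleC_add_right: "a *\<^sub>C (x + y) = a *\<^sub>C x + a *\<^sub>C y"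
    and scaleC_add_left: "(a + b) *\<^sub>C x = a *\<^sub>C x + b *\<^sub>C x"
    and scaleC_scaleC: "a *\<^sub>C b *\<^sub>C x = (a * b) *\<^sub>C x"
    and scaleC_one: "1 *\<^sub>C x = x"
    and scaleR_scaleC: "r *\<^sub>R x = complex_of_real r *\<^sub>C x"
    and cinner_commute: "cinner x y = cnj (cinner y x)"
    and cinner_add_left: "cinner (x + y) z = cinner x z + cinner y z"
    and cinner_scaleC_left: "cinner (a *\<^sub>C x) y = a * cinner x y"
    and inner_eq_Re_cinner: "inner x y = Re (cinner x y)"

class chilbert_space = complex_inner + complete_space

global_interpretation complex_vector: vector_space "scaleC :: complex \<Rightarrow> 'a \<Rightarrow> 'a::complex_inner"
  defines csubspace = complex_vector.subspace
    and cspan = complex_vector.span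
  by unfold_locales (simp_all add: scaleC_add_right scaleC_add_left scaleC_scaleC scaleC_one)

definition bounded_clinear :: "('a::complex_inner \<Rightarrow> 'b::complex_inner) \<Rightarrow> bool" where
  "bounded_clinear f \<longleftrightarrow> bounded_linear f \<and> (\<forall>c x. f (c *\<^sub>C x) = c *\<^sub>C f x)"

definition ortho_compl :: "'a::complex_inner set \<Rightarrow> 'a set" where
  "ortho_compl M = {x. \<forall>m\<in>M. cinner x m = 0}"

text \<open>Only meaningful when \<open>M\<close> is a closed subspace of a Hilbert space.\<close>

definition ortho_proj :: "'a::complex_inner set \<Rightarrow> 'a \<Rightarrow> 'a" where
  "ortho_proj M x = (THE p. p \<in> M \<and> x - p \<in> ortho_compl M)"


section \<open>Operators with a domain\<close>

text \<open>
  An operator \<open>A : D(A) \<subseteq> H\<^sub>1 \<rightarrow> H\<^sub>2\<close> is a partial map \<open>A :: 'a \<rightharpoonup> 'b\<close>, so that \<open>D(A)\<close> is \<open>dom A\<close>,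
  \<open>R(A)\<close> is \<open>ran A\<close>, the product \<open>AB\<close> with its natural domain \<open>{x \<in> D(B). B x \<in> D(A)}\<close> is
  \<open>A \<circ>\<^sub>m B\<close>, and equality of operators includes equality of their domains. The identity operator
  is \<open>Some\<close>.
\<close>

definition linear_op :: "('a::complex_inner \<rightharpoonup> 'b::complex_inner) \<Rightarrow> bool" where
  "linear_op A \<longleftrightarrow> csubspace (dom A)
     \<and> (\<forall>x\<in>dom A. \<forall>y\<in>dom A. the (A (x + y)) = the (A x) + the (A y))
     \<and> (\<forall>c. \<forall>x\<in>dom A. the (A (c *\<^sub>C x)) = c *\<^sub>C the (A x))"

definition densely_defined :: "('a::complex_inner \<rightharpoonup> 'b::complex_inner) \<Rightarrow> bool" where
  "densely_defined A \<longleftrightarrow> closure (dom A) = UNIV"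

definition closed_op :: "('a::complex_inner \<rightharpoonup> 'b::complex_inner) \<Rightarrow> bool" where
  "closed_op A \<longleftrightarrow> closed (Map.graph A)"

definition null_space :: "('a::complex_inner \<rightharpoonup> 'b::complex_inner) \<Rightarrow> 'a set" where
  "null_space A = {x. A x = Some 0}"

definition total_op :: "('a \<Rightarrow> 'b) \<Rightarrow> ('a \<rightharpoonup> 'b)" where
  "total_op f = (\<lambda>x. Some (f x))"

text \<open>
  The sum has domain \<open>D(A) \<inter> D(B)\<close>, which is \<open>D(A)\<close> when \<open>B\<close> is defined everywhere.
\<close>

definition op_plus :: "('a \<rightharpoonup> 'b::complex_inner) \<Rightarrow> ('a \<rightharpoonup> 'b) \<Rightarrow> ('a \<rightharpoonup> 'b)"  (infixl "\<oplus>" 65) where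
  "A \<oplus> B = (\<lambda>x. if x \<in> dom A \<inter> dom B then Some (the (A x) + the (B x)) else None)"

definition op_inverse :: "('a \<rightharpoonup> 'b) \<Rightarrow> ('b \<rightharpoonup> 'a)" where
  "op_inverse A = (\<lambda>y. if \<exists>!x. A x = Some y then Some (THE x. A x = Some y) else None)"

definition boundedly_invertible :: "('a::complex_inner \<rightharpoonup> 'a) \<Rightarrow> bool" where
  "boundedly_invertible A \<longleftrightarrow>
     (\<exists>F G. A = total_op F \<and> bounded_clinear F \<and> bounded_clinear G \<and> F \<circ> G = id \<and> G \<circ> F = id)"


section \<open>The Moore--Penrose inverse\<close>

definition is_mp_inverse ::
    "('a::chilbert_space \<rightharpoonup> 'b::chilbert_space) \<Rightarrow> ('b \<rightharpoonup> 'a) \<Rightarrow> bool" where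
  "is_mp_inverse T X \<longleftrightarrow>
     linear_op X \<and> densely_defined X \<and> closed_op X
     \<and> dom X = {u + v | u v. u \<in> ran T \<and> v \<in> ortho_compl (ran T)}
     \<and> (\<forall>y\<in>dom X. (T \<circ>\<^sub>m X) y = Some (ortho_proj (closure (ran T)) y))
     \<and> (\<forall>x\<in>dom T. (X \<circ>\<^sub>m T) x = Some (ortho_proj (ortho_compl (null_space T)) x))
     \<and> null_space X = ortho_compl (ran T)"

text \<open>
  For a densely defined closed linear \<open>T\<close> there is exactly one such operator.
\<close>

definition mp_inverse :: "('a::chilbert_space \<rightharpoonup> 'b::chilbert_space) \<Rightarrow> ('b \<rightharpoonup> 'a)"
    ("_\<^sup>\<dagger>" [1000] 999) where
  "T\<^sup>\<dagger> = (THE X. is_mp_inverse T X)"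

end

theory Submission
  imports Defs
begin

text \<open>
  Since \<open>R(T)\<close> is closed, \<open>T\<^sup>\<dagger>\<close> is everywhere defined, and bounded by the closed graph theorem; call
  it \<open>G\<close>. Then \<open>I + GS\<close> is invertible because \<open>GS\<close> is a contraction, and so is \<open>F = I + SG\<close>, with
  inverse \<open>I - S (I + GS)\<^bsup>-1\<^esup> G\<close>. Hypothesis (3) gives \<open>T + S = F T\<close>. By hypothesis (2), \<open>F\<close> maps
  \<open>R(T)\<close> onto itself, so \<open>T + S\<close> has the same range and the same null space as \<open>T\<close>; moreover \<open>F\<close> is
  the identity on \<open>N(G)\<close> and commutes with the orthogonal projection onto \<open>R(T)\<close>. Hence \<open>G F\<^bsup>-1\<^esup>\<close>
  satisfies the defining properties of \<open>(T + S)\<^sup>\<dagger>\<close>.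
\<close>

section \<open>Closed graphs and orthogonal projections\<close>

instance chilbert_space \<subseteq> banach ..

text \<open>By Baire, the closure of some sublevel set of \<open>norm (f x)\<close> has nonempty
  interior. Linearity then lets every \<open>x\<close> be approximated, up to half its norm, by a
  vector whose image has norm at most \<open>C * norm x\<close>. Repeated correction expands
  \<open>x\<close> in a series whose images are summable, and the closed graph identifies the sum of
  the images with \<open>f x\<close>.\<close>

lemma closed_graph_theorem:
  fixes f :: "'a::banach \<Rightarrow> 'b::banach"
  assumes lin: "linear f" and graph: "closed (range (\<lambda>x. (x, f x)))"
  shows "bounded_linear f"
proof -
  interpret f: linear f by fact
  define A where "A n = closure {x. norm (f x) \<le> real n}" for n
  have "x \<in> (\<Union>n. A n)" for x
    using real_arch_simple[of "norm (f x)"] closure_subset by (fastforce simp: A_def)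
  then have UN: "(\<Union>n. A n) = UNIV" by blast
  have "\<exists>n. interior (A n) \<noteq> {}"
  proof (rule ccontr)
    assume "\<not> ?thesis"
    then have "Met_TC.mtopology interior_of \<Union>(range A) = {}"
      by (intro Met_TC.metric_Baire_category_alt) (auto simp: A_def complete_UNIV)
    then show False by (simp add: UN)
  qed
  then obtain n x0 r where r: "r > 0" "ball x0 r \<subseteq> A n"
    by (metis all_not_in_conv mem_interior)
  \<comment> \<open>Subtracting approximants of \<open>x0 + u\<close> and of \<open>x0\<close>
    removes the centre of the ball, at the price of doubling the bound \<open>n\<close>.\<close>
  have close: "\<exists>a. norm (f a) \<le> 2 * real n \<and> norm (u - a) < e" if "norm u < r" "e > 0" for u e
  proof -
    have "x0 + u \<in> A n" "x0 \<in> A n"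
      using r that by (auto simp: subset_iff dist_norm)
    then obtain a b where ab: "norm (f a) \<le> n" "dist a (x0 + u) < e/2" "norm (f b) \<le> n" "dist b x0 < e/2"
      using \<open>e > 0\<close> unfolding A_def closure_approachable by (metis half_gt_zero mem_Collect_eq)
    have "norm (f (a - b)) \<le> 2 * real n"
      using norm_triangle_ineq4[of "f a" "f b"] ab by (simp add: f.diff)
    moreover have "u - (a - b) = (b - x0) - (a - (x0 + u))" by simp
    then have "norm (u - (a - b)) \<le> norm (b - x0) + norm (a - (x0 + u))"
      by (metis norm_triangle_ineq4)
    then have "norm (u - (a - b)) < e" using ab by (simp add: dist_norm)
    ultimately show ?thesis by blast
  qed
  define C where "C = 2 * real n / (r/2)"
  have C: "C \<ge> 0" using r by (simp add: C_def)
  have "\<exists>a. norm (f a) \<le> C * norm x \<and> norm (x - a) \<le> norm x / 2" for x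
  proof (cases "x = 0")
    case True
    then show ?thesis by (auto intro!: exI[of _ 0])
  next
    case False
    \<comment> \<open>Division by \<open>t\<close> brings \<open>x\<close> to norm
      \<open>r/2\<close>, strictly inside the ball; scaling back turns the error \<open>r/4\<close>
      into \<open>norm x / 2\<close> and the bound \<open>2 * n\<close> into
      \<open>C * norm x\<close>.\<close>
    define t where "t = norm x / (r/2)"
    have t: "t > 0" using False r by (simp add: t_def)
    have nx: "norm x = t * (r/2)" using r by (simp add: t_def)
    then have "norm (x /\<^sub>R t) = r/2" using t by (simp add: field_simps)
    then have "norm (x /\<^sub>R t) < r" using r(1) by linarith
    then obtain a where a: "norm (f a) \<le> 2 * real n" "norm (x /\<^sub>R t - a) < r/4"
      using close[of "x /\<^sub>R t" "r/4"] r by auto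
    have "norm (f (t *\<^sub>R a)) \<le> C * norm x"
      using a t r by (simp add: f.scale C_def nx)
    moreover have "x - t *\<^sub>R a = t *\<^sub>R (x /\<^sub>R t - a)" using t by (simp add: scaleR_diff_right)
    then have "norm (x - t *\<^sub>R a) \<le> norm x / 2"
      using a t by (simp add: nx)
    ultimately show ?thesis by blast
  qed
  then obtain s where s: "\<And>x. norm (f (s x)) \<le> C * norm x" "\<And>x. norm (x - s x) \<le> norm x / 2"
    by metis
  have "norm (f x) \<le> norm x * (2 * C)" for x
  proof -
    \<comment> \<open>\<open>y k\<close> is what remains of \<open>x\<close> after \<open>k\<close> corrections by \<open>s\<close>\<close>
    define y where "y k = ((\<lambda>z. z - s z) ^^ k) x" for k
    have y0: "y 0 = x" and yS: "y (Suc k) = y k - s (y k)" for k by (simp_all add: y_def)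
    have ny: "norm (y k) \<le> norm x * (1/2) ^ k" for k
    proof (induction k)
      case (Suc k)
      then show ?case using s(2)[of "y k"] by (simp add: yS)
    qed (simp add: y0)
    have nf: "norm (f (s (y k))) \<le> C * norm x * (1/2) ^ k" for k
      using s(1)[of "y k"] mult_left_mono[OF ny[of k] C] by (simp add: mult.assoc)
    have geo: "(\<lambda>k. C * norm x * (1/2) ^ k) sums (C * norm x * 2)"
      using sums_mult[OF geometric_sums[of "1/2::real"]] by simp
    have sm: "summable (\<lambda>k. norm (f (s (y k))))"
      by (rule summable_comparison_test'[OF sums_summable[OF geo], of 0]) (use nf in auto)
    define z where "z = (\<Sum>k. f (s (y k)))"
    \<comment> \<open>The corrections telescope: \<open>x - y k\<close> is the sum of the first
      \<open>k\<close> of them.\<close>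
    have part: "f (x - y k) = (\<Sum>i<k. f (s (y i)))" for k
    proof (induction k)
      case (Suc k)
      have "f (x - y (Suc k)) = f (x - y k) + f (s (y k))"
        by (simp add: yS algebra_simps flip: f.add)
      with Suc show ?case by simp
    qed (simp add: y0)
    have "(\<lambda>k. f (x - y k)) \<longlonglongrightarrow> z"
      unfolding part z_def by (intro summable_LIMSEQ summable_norm_cancel[OF sm])
    moreover have "y \<longlonglongrightarrow> 0"
      by (rule Lim_null_comparison[OF always_eventually[OF allI[OF ny]]])
        (intro tendsto_mult_right_zero LIMSEQ_realpow_zero, auto)
    then have "(\<lambda>k. x - y k) \<longlonglongrightarrow> x" using tendsto_diff[OF tendsto_const[of x]] by fastforce
    ultimately have "(\<lambda>k. (x - y k, f (x - y k))) \<longlonglongrightarrow> (x, z)" by (intro tendsto_Pair)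
    then have "(x, z) \<in> range (\<lambda>x. (x, f x))"
      by (rule closed_sequentially[OF graph, rotated]) auto
    then have "f x = z" by auto
    also have "norm z \<le> (\<Sum>k. norm (f (s (y k))))"
      unfolding z_def by (rule summable_norm[OF sm])
    also have "\<dots> \<le> C * norm x * 2"
      using suminf_le[OF nf sm sums_summable[OF geo]] sums_unique[OF geo] by simp
    finally show ?thesis by (simp add: mult_ac)
  qed
  then show ?thesis by (intro bounded_linear_intro[of f "2 * C"]) (auto simp: f.add f.scale)
qed

text \<open>A minimising sequence for the distance from \<open>x\<close> to \<open>M\<close> is
  Cauchy by the parallelogram law. Its limit \<open>q\<close> is a nearest point, and minimality
  along each line through \<open>q\<close> in \<open>M\<close> forces orthogonality.\<close>

lemma orthogonal_decomposition:
  fixes M :: "'a::{real_inner,complete_space} set"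
  assumes "subspace M" "closed M"
  shows "\<exists>p\<in>M. \<forall>m\<in>M. inner (x - p) m = 0"
proof -
  define d where "d = infdist x M"
  have "M \<noteq> {}" using subspace_0[OF assms(1)] by auto
  have d_le: "d\<^sup>2 \<le> (norm (x - m))\<^sup>2" if "m \<in> M" for m
    using infdist_le[OF that, of x] infdist_nonneg[of x M] by (simp add: d_def dist_norm power_mono)
  have "\<exists>m\<in>M. (norm (x - m))\<^sup>2 < d\<^sup>2 + e" if "e > 0" for e
  proof -
    have "d < sqrt (d\<^sup>2 + e)" using that infdist_nonneg[of x M]
      by (intro real_less_rsqrt) (simp add: d_def)
    then obtain m where "m \<in> M" "dist x m < sqrt (d\<^sup>2 + e)"
      using \<open>M \<noteq> {}\<close> cInf_less_iff[of "dist x ` M" "sqrt (d\<^sup>2 + e)"] by (auto simp: d_def infdist_def)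
    then have "(norm (x - m))\<^sup>2 < (sqrt (d\<^sup>2 + e))\<^sup>2"
      by (intro power_strict_mono) (auto simp: dist_norm)
    with \<open>m \<in> M\<close> that show ?thesis by (auto intro!: bexI[of _ m])
  qed
  then have "\<forall>n::nat. \<exists>m\<in>M. (norm (x - m))\<^sup>2 < d\<^sup>2 + inverse (Suc n)"
    by (metis inverse_positive_iff_positive of_nat_0_less_iff zero_less_Suc)
  then obtain p where p: "\<And>n::nat. p n \<in> M" "\<And>n::nat. (norm (x - p n))\<^sup>2 < d\<^sup>2 + inverse (Suc n)"
    by metis
  have par: "(norm (p m - p n))\<^sup>2 < 2 * inverse (Suc m) + 2 * inverse (Suc n)" for m n
  proof -
    \<comment> \<open>The midpoint lies in \<open>M\<close>, hence at distance at least
      \<open>d\<close> from \<open>x\<close>; this bounds the sum term in the parallelogram law from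
      below.\<close>
    have "(1/2) *\<^sub>R (p m + p n) \<in> M"
      using assms(1) p by (intro subspace_scale subspace_add)
    from d_le[OF this] have "4 * d\<^sup>2 \<le> (norm (2 *\<^sub>R (x - (1/2) *\<^sub>R (p m + p n))))\<^sup>2"
      by (simp add: power_mult_distrib)
    also have "2 *\<^sub>R (x - (1/2) *\<^sub>R (p m + p n)) = (x - p m) + (x - p n)"
      by (simp add: algebra_simps scaleR_2)
    finally have "4 * d\<^sup>2 \<le> (norm ((x - p m) + (x - p n)))\<^sup>2" .
    moreover have "(norm (p m - p n))\<^sup>2 + (norm ((x - p m) + (x - p n)))\<^sup>2
        = 2 * (norm (x - p m))\<^sup>2 + 2 * (norm (x - p n))\<^sup>2"
      by (simp add: power2_norm_eq_inner inner_simps inner_commute algebra_simps)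
    ultimately show ?thesis using p(2)[of m] p(2)[of n] by linarith
  qed
  have "Cauchy p"
  proof (rule metric_CauchyI)
    fix e :: real assume "e > 0"
    then obtain N where N: "inverse (Suc N) < e\<^sup>2 / 4"
      using reals_Archimedean[of "e\<^sup>2 / 4"] by auto
    have "dist (p m) (p n) < e" if "m \<ge> N" "n \<ge> N" for m n
    proof -
      have "inverse (real (Suc m)) \<le> inverse (Suc N)" "inverse (real (Suc n)) \<le> inverse (Suc N)"
        using that by (auto intro!: le_imp_inverse_le)
      then have "(norm (p m - p n))\<^sup>2 < e\<^sup>2" using par[of m n] N by linarith
      then show ?thesis using \<open>e > 0\<close> by (simp add: dist_norm power_less_imp_less_base)
    qed
    then show "\<exists>N. \<forall>m\<ge>N. \<forall>n\<ge>N. dist (p m) (p n) < e" by blast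
  qed
  then obtain q where q: "p \<longlonglongrightarrow> q" by (meson Cauchy_convergent convergent_def)
  have qM: "q \<in> M" using closed_sequentially[OF assms(2) _ q] p by blast
  have "(norm (x - q))\<^sup>2 \<le> d\<^sup>2 + 0"
  proof (rule LIMSEQ_le)
    show "(\<lambda>n. (norm (x - p n))\<^sup>2) \<longlonglongrightarrow> (norm (x - q))\<^sup>2" by (intro tendsto_intros q)
    show "(\<lambda>n. d\<^sup>2 + inverse (real (Suc n))) \<longlonglongrightarrow> d\<^sup>2 + 0"
      by (intro tendsto_intros LIMSEQ_inverse_real_of_nat)
  qed (use p less_imp_le in blast)
  then have le: "(norm (x - q))\<^sup>2 \<le> (norm (x - m))\<^sup>2" if "m \<in> M" for m using d_le[OF that] by linarith
  have "inner (x - q) m = 0" if "m \<in> M" for m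
  proof (cases "m = 0")
    case False
    \<comment> \<open>This \<open>t\<close> minimises the distance from \<open>x - q\<close> to the
      multiples of \<open>m\<close>.\<close>
    define t where "t = inner (x - q) m / (norm m)\<^sup>2"
    have "(norm (x - q))\<^sup>2 \<le> (norm ((x - q) - t *\<^sub>R m))\<^sup>2"
      using le[of "q + t *\<^sub>R m"] that qM assms(1) by (simp add: subspace_add subspace_scale algebra_simps)
    also have "\<dots> = (norm (x - q))\<^sup>2 - 2 * t * inner (x - q) m + t * (t * (norm m)\<^sup>2)"
      unfolding power2_norm_eq_inner by (simp add: inner_diff_left inner_diff_right inner_commute algebra_simps)
    also have "t * (norm m)\<^sup>2 = inner (x - q) m" using False by (simp add: t_def)
    finally have "t * inner (x - q) m \<le> 0" by simp
    moreover have "t * inner (x - q) m = (inner (x - q) m)\<^sup>2 / (norm m)\<^sup>2"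
      by (simp add: t_def power2_eq_square)
    ultimately show ?thesis using False by (simp add: divide_le_0_iff)
  qed simp
  with qM show ?thesis by blast
qed

section \<open>Orthogonality and projections for the complex inner product\<close>

lemma scaleC_minus1: "(- 1) *\<^sub>C x = - (x :: 'a::complex_inner)"
  using complex_vector.scale_minus_left[of 1 x] by simp

lemma csubspace_imp_subspace: "csubspace M \<Longrightarrow> subspace M"
  by (auto simp: subspace_def complex_vector.subspace_def scaleR_scaleC)

lemma cinner_scaleC_right: "cinner x (c *\<^sub>C y) = cnj c * cinner x y"
  by (metis cinner_commute cinner_scaleC_left complex_cnj_mult)

text \<open>The bridge to the real theory: real orthogonality to both \<open>y\<close> and
  \<open>\<i> *\<^sub>C y\<close> is complex orthogonality to \<open>y\<close>.\<close>

lemma cinner_eq_Complex_inner: "cinner x y = Complex (inner x y) (inner x (\<i> *\<^sub>C y))"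
  by (simp add: complex_eq_iff inner_eq_Re_cinner cinner_scaleC_right)

lemma ortho_compl_csubspace: "csubspace (ortho_compl M)"
proof -
  have "cinner 0 y = 0" for y :: 'a
    using cinner_scaleC_left[of 0 0 y] by simp
  then show ?thesis
    by (auto simp: complex_vector.subspace_def ortho_compl_def cinner_add_left cinner_scaleC_left)
qed

lemma closed_ortho_compl: "closed (ortho_compl M)"
proof -
  have "ortho_compl M = (\<Inter>m\<in>M. {x. inner x m = 0} \<inter> {x. inner x (\<i> *\<^sub>C m) = 0})"
    by (auto simp: ortho_compl_def cinner_eq_Complex_inner complex_eq_iff)
  also have "closed \<dots>"
    by (intro closed_INT ballI closed_Int closed_Collect_eq continuous_intros)
  finally show ?thesis .
qed

lemma ortho_compl_self:
  assumes "x \<in> M" "x \<in> ortho_compl M" shows "x = 0"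
  using assms by (auto simp: ortho_compl_def cinner_eq_Complex_inner complex_eq_iff)

lemma ortho_compl_ortho_compl: "M \<subseteq> ortho_compl (ortho_compl M)"
  by (auto simp: ortho_compl_def) (metis cinner_commute complex_cnj_zero)

text \<open>Two candidates differ by a vector lying both in \<open>M\<close> and in its complement,
  so they coincide.\<close>

lemma ortho_proj_eqI:
  assumes "csubspace M" "p \<in> M" "x - p \<in> ortho_compl M"
  shows "ortho_proj M x = p"
  unfolding ortho_proj_def
proof (rule the_equality)
  fix q assume q: "q \<in> M \<and> x - q \<in> ortho_compl M"
  have "q - p \<in> M" using assms q by (simp add: complex_vector.subspace_diff)
  moreover have "(x - p) - (x - q) \<in> ortho_compl M"
    using complex_vector.subspace_diff[OF ortho_compl_csubspace] assms q by blast
  then have "q - p \<in> ortho_compl M" by simp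
  ultimately show "q = p" using ortho_compl_self by fastforce
qed (use assms in simp)

text \<open>The decomposition for the real inner product suffices, because \<open>M\<close> is
  stable under multiplication by \<open>\<i>\<close>.\<close>

lemma ortho_proj_props:
  fixes M :: "'a::chilbert_space set"
  assumes "csubspace M" "closed M"
  shows "ortho_proj M x \<in> M" "x - ortho_proj M x \<in> ortho_compl M"
proof -
  obtain p where p: "p \<in> M" "\<And>m. m \<in> M \<Longrightarrow> inner (x - p) m = 0"
    using orthogonal_decomposition[OF csubspace_imp_subspace[OF assms(1)] assms(2)] by blast
  then have "x - p \<in> ortho_compl M"
    by (simp add: ortho_compl_def cinner_eq_Complex_inner complex_eq_iff
        complex_vector.subspace_scale[OF assms(1)])
  with p show "ortho_proj M x \<in> M" "x - ortho_proj M x \<in> ortho_compl M"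
    using ortho_proj_eqI[OF assms(1)] by auto
qed

lemma ortho_proj_bounded_clinear:
  fixes M :: "'a::chilbert_space set"
  assumes "csubspace M" "closed M"
  shows "bounded_clinear (ortho_proj M)"
proof -
  note pr = ortho_proj_props[OF assms]
  have add: "ortho_proj M (x + y) = ortho_proj M x + ortho_proj M y" for x y
    using complex_vector.subspace_add[OF ortho_compl_csubspace pr(2)[of x] pr(2)[of y]]
    by (intro ortho_proj_eqI complex_vector.subspace_add assms pr) (simp add: algebra_simps)
  have scale: "ortho_proj M (c *\<^sub>C x) = c *\<^sub>C ortho_proj M x" for c x
    using complex_vector.subspace_scale[OF ortho_compl_csubspace pr(2)[of x], of c]
    by (intro ortho_proj_eqI complex_vector.subspace_scale assms pr)
      (simp add: complex_vector.scale_right_diff_distrib)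
  \<comment> \<open>Orthogonality turns the squared norm of the projection into its inner product
    with \<open>x\<close>; Cauchy-Schwarz does the rest.\<close>
  have "norm (ortho_proj M x) \<le> norm x * 1" for x
  proof -
    have "inner (x - ortho_proj M x) (ortho_proj M x) = 0"
      using pr[of x] by (auto simp: ortho_compl_def inner_eq_Re_cinner)
    then have "(norm (ortho_proj M x))\<^sup>2 \<le> norm x * norm (ortho_proj M x)"
      using norm_cauchy_schwarz[of x "ortho_proj M x"]
      by (simp add: power2_norm_eq_inner inner_diff_left)
    then show ?thesis by (cases "ortho_proj M x = 0") (auto simp: power2_eq_square)
  qed
  then have "bounded_linear (ortho_proj M)"
    by (intro bounded_linear_intro[of _ 1]) (auto simp: add scale scaleR_scaleC)
  with scale show ?thesis by (simp add: bounded_clinear_def)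
qed

section \<open>Operators with a domain\<close>

lemma total_op_apply [simp]: "total_op f x = Some (f x)"
  by (simp add: total_op_def)

lemma dom_total_op [simp]: "dom (total_op f) = UNIV"
  by (auto simp: dom_def)

lemma map_comp_total_op [simp]: "(A \<circ>\<^sub>m total_op f) x = A (f x)"
  by (simp add: map_comp_def)

lemma linear_opI:
  assumes "csubspace (dom A)"
    and "\<And>x y u v. A x = Some u \<Longrightarrow> A y = Some v \<Longrightarrow> A (x + y) = Some (u + v)"
    and "\<And>c x u. A x = Some u \<Longrightarrow> A (c *\<^sub>C x) = Some (c *\<^sub>C u)"
  shows "linear_op A"
  unfolding linear_op_def
proof (intro conjI ballI allI assms(1))
  fix x y assume "x \<in> dom A" "y \<in> dom A"
  then obtain u v where "A x = Some u" "A y = Some v" by blast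
  with assms(2)[OF this] show "the (A (x + y)) = the (A x) + the (A y)" by simp
next
  fix c x assume "x \<in> dom A"
  then obtain u where "A x = Some u" by blast
  with assms(3)[OF this] show "the (A (c *\<^sub>C x)) = c *\<^sub>C the (A x)" by simp
qed

lemma linear_op_add:
  assumes "linear_op A" "A x = Some u" "A y = Some v"
  shows "A (x + y) = Some (u + v)"
proof -
  have "x + y \<in> dom A"
    using assms domI[of A, OF assms(2)] domI[of A, OF assms(3)]
    by (simp add: linear_op_def complex_vector.subspace_add)
  moreover have "the (A (x + y)) = u + v"
    using assms domI[of A, OF assms(2)] domI[of A, OF assms(3)] by (simp add: linear_op_def)
  ultimately show ?thesis by force
qed

lemma linear_op_scaleC:
  assumes "linear_op A" "A x = Some u"
  shows "A (c *\<^sub>C x) = Some (c *\<^sub>C u)"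
proof -
  have "c *\<^sub>C x \<in> dom A"
    using assms domI[of A, OF assms(2)] by (simp add: linear_op_def complex_vector.subspace_scale)
  moreover have "the (A (c *\<^sub>C x)) = c *\<^sub>C u"
    using assms domI[of A, OF assms(2)] by (simp add: linear_op_def)
  ultimately show ?thesis by force
qed

lemma linear_op_zero:
  assumes "linear_op A" shows "A 0 = Some 0"
proof -
  obtain u where "A 0 = Some u"
    using assms complex_vector.subspace_0 unfolding linear_op_def by blast
  with linear_op_scaleC[OF assms this, of 0] show ?thesis by simp
qed

lemma linear_op_diff:
  assumes "linear_op A" "A x = Some u" "A y = Some v"
  shows "A (x - y) = Some (u - v)"
  using linear_op_add[OF assms(1,2) linear_op_scaleC[OF assms(1,3), of "-1"]]
  by (simp add: scaleC_minus1)

lemma csubspace_ran: "linear_op A \<Longrightarrow> csubspace (ran A)"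
  unfolding complex_vector.subspace_def ran_def
  by (blast intro: linear_op_add linear_op_scaleC linear_op_zero)

lemma csubspace_null_space:
  assumes "linear_op A" shows "csubspace (null_space A)"
  using linear_op_add[OF assms] linear_op_scaleC[OF assms] linear_op_zero[OF assms]
  by (fastforce simp: complex_vector.subspace_def null_space_def)

lemma closed_null_space:
  assumes "closed_op A" shows "closed (null_space A)"
proof -
  have "null_space A = (\<lambda>x. (x, 0)) -` Map.graph A"
    by (auto simp: null_space_def Map.graph_def)
  moreover have "closed \<dots>"
    using assms unfolding closed_op_def by (intro closed_vimage continuous_intros)
  ultimately show ?thesis by simp
qed

text \<open>The difference \<open>x - y\<close> lies in the null space and in its complement. Values
  of Moore-Penrose inverses are identified through this injectivity.\<close>

lemma null_space_ortho_compl_inj: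
  assumes "linear_op A" "A x = Some u" "A y = Some u"
    and "x \<in> ortho_compl (null_space A)" "y \<in> ortho_compl (null_space A)"
  shows "x = y"
proof -
  have "x - y \<in> null_space A" using linear_op_diff[OF assms(1-3)] by (simp add: null_space_def)
  moreover have "x - y \<in> ortho_compl (null_space A)"
    using assms(4,5) by (intro complex_vector.subspace_diff ortho_compl_csubspace)
  ultimately show ?thesis using ortho_compl_self by fastforce
qed

lemma closed_op_total_op:
  assumes "bounded_clinear f" shows "closed_op (total_op f)"
proof -
  have "continuous_on UNIV f"
    using assms by (simp add: bounded_clinear_def linear_continuous_on)
  then have "continuous_on UNIV (\<lambda>p. f (fst p))"
    by (rule continuous_on_compose2[OF _ continuous_on_fst[OF continuous_on_id]]) simp
  then have "closed {p. f (fst p) = snd p}"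
    by (intro closed_Collect_eq continuous_on_snd continuous_on_id)
  also have "{p. f (fst p) = snd p} = Map.graph (total_op f)"
    by (auto simp: Map.graph_def)
  finally show ?thesis by (simp add: closed_op_def)
qed

lemma linear_op_total_op: "bounded_clinear f \<Longrightarrow> linear_op (total_op f)"
  by (simp add: linear_op_def bounded_clinear_def linear_add bounded_linear.linear)

section \<open>The Moore--Penrose inverse\<close>

text \<open>The value at \<open>y\<close> is forced: it is the only preimage under \<open>T\<close>
  of the projection of \<open>y\<close> that is orthogonal to the null space of
  \<open>T\<close>.\<close>

lemma is_mp_inverse_unique:
  assumes T: "linear_op T" and X: "is_mp_inverse T X" and Y: "is_mp_inverse T Y"
  shows "X = Y"
proof -
  have mem: "T x = Some (ortho_proj (closure (ran T)) y) \<and> x \<in> ortho_compl (null_space T)"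
    if Z: "is_mp_inverse T Z" and y: "Z y = Some x" for Z x y
  proof
    from Z have Z': "linear_op Z" "dom Z = {u + v |u v. u \<in> ran T \<and> v \<in> ortho_compl (ran T)}"
      "\<And>y. y \<in> dom Z \<Longrightarrow> (T \<circ>\<^sub>m Z) y = Some (ortho_proj (closure (ran T)) y)"
      "\<And>x. x \<in> dom T \<Longrightarrow> (Z \<circ>\<^sub>m T) x = Some (ortho_proj (ortho_compl (null_space T)) x)"
      "null_space Z = ortho_compl (ran T)"
      by (auto simp: is_mp_inverse_def)
    show "T x = Some (ortho_proj (closure (ran T)) y)"
      using Z'(3)[of y] y by (auto simp: map_comp_def)
    \<comment> \<open>\<open>Z\<close> kills the component \<open>v\<close>, and on
      \<open>u = T z\<close> it returns a projection onto the complement of the null space.\<close>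
    obtain u v where uv: "y = u + v" "u \<in> ran T" "v \<in> ortho_compl (ran T)"
      using y Z'(2) by blast
    then obtain z where z: "T z = Some u" by (auto simp: ran_def)
    have "Z v = Some 0" using uv Z'(5) by (auto simp: null_space_def)
    moreover have "Z u = Some (ortho_proj (ortho_compl (null_space T)) z)"
      using Z'(4)[of z] z by (auto simp: map_comp_def)
    ultimately have "Z y = Some (ortho_proj (ortho_compl (null_space T)) z)"
      using linear_op_add[OF Z'(1)] uv(1) by fastforce
    then show "x \<in> ortho_compl (null_space T)"
      using y ortho_proj_props(1)[OF ortho_compl_csubspace closed_ortho_compl] by fastforce
  qed
  have dom: "dom X = dom Y" using X Y by (simp add: is_mp_inverse_def)
  show ?thesis
  proof
    fix y
    show "X y = Y y"
    proof (cases "y \<in> dom X")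
      case True
      then obtain a b where "X y = Some a" "Y y = Some b" using dom by blast
      with null_space_ortho_compl_inj[OF T] mem[OF X, of y a] mem[OF Y, of y b] show ?thesis by simp
    next
      case False
      with dom show ?thesis by (metis domIff)
    qed
  qed
qed

lemma mp_inverse_eqI: "linear_op T \<Longrightarrow> is_mp_inverse T X \<Longrightarrow> T\<^sup>\<dagger> = X"
  unfolding mp_inverse_def by (blast intro: the_equality is_mp_inverse_unique)

text \<open>A closed range and its orthogonal complement together span the whole space, and a
  bounded total operator is linear and closed; only the three algebraic conditions remain to be
  checked.\<close>

lemma is_mp_inverse_total_op_iff:
  assumes "linear_op T" "closed (ran T)" "bounded_clinear G"
  shows "is_mp_inverse T (total_op G) \<longleftrightarrow>
    (\<forall>y. T (G y) = Some (ortho_proj (ran T) y))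
    \<and> (\<forall>x\<in>dom T. G (the (T x)) = ortho_proj (ortho_compl (null_space T)) x)
    \<and> {y. G y = 0} = ortho_compl (ran T)"
proof -
  note pr = ortho_proj_props[OF csubspace_ran[OF assms(1)] assms(2)]
  have "y \<in> {u + v |u v. u \<in> ran T \<and> v \<in> ortho_compl (ran T)}" for y
  proof -
    have "y = ortho_proj (ran T) y + (y - ortho_proj (ran T) y)" by simp
    with pr[of y] show ?thesis by blast
  qed
  then have dom: "{u + v |u v. u \<in> ran T \<and> v \<in> ortho_compl (ran T)} = UNIV" by blast
  have "(total_op G \<circ>\<^sub>m T) x = Some (G (the (T x)))" if "x \<in> dom T" for x
    using that by (auto simp: map_comp_def)
  then show ?thesis
    using assms linear_op_total_op[OF assms(3)] closed_op_total_op[OF assms(3)]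
    by (simp add: is_mp_inverse_def densely_defined_def dom null_space_def[of "total_op G"])
qed

text \<open>\<open>G y\<close> is chosen as the preimage of \<open>P y\<close> orthogonal to the
  null space. Its uniqueness gives linearity, and closedness of \<open>T\<close> gives a closed
  graph, hence boundedness.\<close>

lemma mp_inverse_exists:
  assumes T: "linear_op T" "closed_op T" and R: "closed (ran T)"
  obtains G where "bounded_clinear G" "is_mp_inverse T (total_op G)"
proof -
  define P where "P = ortho_proj (ran T)"
  let ?N = "null_space T"
  note prP = ortho_proj_props[OF csubspace_ran[OF T(1)] R, folded P_def]
  note prN = ortho_proj_props[OF csubspace_null_space[OF T(1)] closed_null_space[OF T(2)]]
  have projN: "ortho_proj (ortho_compl ?N) x = x - ortho_proj ?N x" for x
    using prN[of x] ortho_compl_ortho_compl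
    by (intro ortho_proj_eqI[OF ortho_compl_csubspace]) auto
  \<comment> \<open>Projecting changes \<open>x\<close> only by a null vector of
    \<open>T\<close>.\<close>
  have T_projN: "T (ortho_proj (ortho_compl ?N) x) = Some u" if "T x = Some u" for x u
    using linear_op_diff[OF T(1) that, of "ortho_proj ?N x" 0] prN(1)[of x]
    unfolding projN by (simp add: null_space_def)
  have "\<exists>x. x \<in> ortho_compl ?N \<and> T x = Some (P y)" for y
  proof -
    obtain x where "T x = Some (P y)" using prP(1)[of y] by (auto simp: ran_def)
    with T_projN[OF this] ortho_proj_props(1)[OF ortho_compl_csubspace closed_ortho_compl]
    show ?thesis by blast
  qed
  then obtain G where G: "\<And>y. G y \<in> ortho_compl ?N" "\<And>y. T (G y) = Some (P y)" by metis
  \<comment> \<open>To identify \<open>G y\<close> with a vector, it suffices that the vector is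
    sent to \<open>P y\<close> by \<open>T\<close> and is orthogonal to the null space.\<close>
  note G_eqI = null_space_ortho_compl_inj[OF T(1) G(2) _ G(1)]
  have bP: "bounded_clinear P"
    unfolding P_def by (rule ortho_proj_bounded_clinear[OF csubspace_ran[OF T(1)] R])
  then have P: "bounded_linear P" "\<And>c x. P (c *\<^sub>C x) = c *\<^sub>C P x"
    by (auto simp: bounded_clinear_def)
  note P_add = linear_add[OF bounded_linear.linear[OF P(1)]]
  have add: "G (x + y) = G x + G y" for x y
    using linear_op_add[OF T(1) G(2) G(2)] P_add
    by (intro G_eqI complex_vector.subspace_add ortho_compl_csubspace G(1)) simp
  have scale: "G (c *\<^sub>C x) = c *\<^sub>C G x" for c x
    using linear_op_scaleC[OF T(1) G(2)] P(2)
    by (intro G_eqI complex_vector.subspace_scale ortho_compl_csubspace G(1)) simp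
  have G_iff: "x = G y \<longleftrightarrow> T x = Some (P y) \<and> x \<in> ortho_compl ?N" for x y
    using G G_eqI by metis
  have "range (\<lambda>y. (y, G y)) = {q. snd q = G (fst q)}" by force
  \<comment> \<open>This characterisation of \<open>G\<close> exhibits its graph as an intersection
    of preimages of closed sets under continuous maps.\<close>
  also have "\<dots> = (\<lambda>q. (snd q, P (fst q))) -` Map.graph T \<inter> snd -` ortho_compl ?N"
    by (auto simp: G_iff Map.graph_def)
  also have "closed \<dots>"
  proof (intro closed_Int closed_vimage)
    show "closed (Map.graph T)" using T(2) by (simp add: closed_op_def)
    show "continuous_on UNIV (\<lambda>q. (snd q, P (fst q)))"
      by (intro continuous_on_Pair continuous_on_snd continuous_on_fst continuous_on_id
          bounded_linear.continuous_on[OF P(1)])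
  qed (auto intro: closed_ortho_compl continuous_on_snd continuous_on_id)
  finally have "bounded_linear G"
    by (intro closed_graph_theorem linearI) (simp_all add: add scale scaleR_scaleC)
  with scale have bG: "bounded_clinear G" by (simp add: bounded_clinear_def)
  have "G (the (T x)) = ortho_proj (ortho_compl ?N) x" if x: "x \<in> dom T" for x
  proof -
    obtain u where u: "T x = Some u" using x by blast
    then have "u \<in> ran T" by (auto simp: ran_def)
    then have "P u = u"
      unfolding P_def using ortho_compl_csubspace
      by (intro ortho_proj_eqI csubspace_ran T) (auto intro: complex_vector.subspace_0)
    then show ?thesis
      using T_projN[OF u] ortho_proj_props(1)[OF ortho_compl_csubspace closed_ortho_compl]
      by (intro G_eqI) (simp_all add: u)
  qed
  moreover have "G y = 0 \<longleftrightarrow> y \<in> ortho_compl (ran T)" for y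
  proof
    assume "G y = 0"
    then have "P y = 0" using G(2)[of y] linear_op_zero[OF T(1)] by simp
    then show "y \<in> ortho_compl (ran T)" using prP(2)[of y] by simp
  next
    assume "y \<in> ortho_compl (ran T)"
    then have "P y = 0"
      unfolding P_def using complex_vector.subspace_0 csubspace_ran[OF T(1)]
      by (intro ortho_proj_eqI) auto
    then show "G y = 0"
      by (intro G_eqI) (auto simp: linear_op_zero[OF T(1)] complex_vector.subspace_0[OF ortho_compl_csubspace])
  qed
  ultimately show ?thesis
    using that[OF bG] is_mp_inverse_total_op_iff[OF T(1) R bG] G(2) unfolding P_def by blast
qed

section \<open>Perturbation\<close>

lemma bounded_clinear_compose:
  "bounded_clinear f \<Longrightarrow> bounded_clinear g \<Longrightarrow> bounded_clinear (\<lambda>x. f (g x))"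
  by (auto simp: bounded_clinear_def intro: bounded_linear_compose)

lemma bounded_clinear_ident: "bounded_clinear (\<lambda>x. x)"
  by (simp add: bounded_clinear_def bounded_linear_ident)

lemma bounded_clinear_add:
  "bounded_clinear f \<Longrightarrow> bounded_clinear g \<Longrightarrow> bounded_clinear (\<lambda>x. f x + g x)"
  by (auto simp: bounded_clinear_def scaleC_add_right intro: bounded_linear_add)

lemma bounded_clinear_diff:
  "bounded_clinear f \<Longrightarrow> bounded_clinear g \<Longrightarrow> bounded_clinear (\<lambda>x. f x - g x)"
  by (auto simp: bounded_clinear_def complex_vector.scale_right_diff_distrib intro: bounded_linear_sub)

lemma bounded_clinear_add_apply: "bounded_clinear f \<Longrightarrow> f (x + y) = f x + f y"
  and bounded_clinear_diff_apply: "bounded_clinear f \<Longrightarrow> f (x - y) = f x - f y"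
  by (simp_all add: bounded_clinear_def bounded_linear.linear linear_add linear_diff)

text \<open>Solutions of \<open>x + K x = y\<close> are the fixed points of the contraction sending
  \<open>x\<close> to \<open>y - K x\<close>, so Banach's theorem provides the inverse. The bound
  \<open>1 / (1 - onorm K)\<close> comes from the triangle inequality.\<close>

lemma id_plus_contraction_inverse:
  fixes K :: "'a::chilbert_space \<Rightarrow> 'a"
  assumes K: "bounded_clinear K" and less: "onorm K < 1"
  obtains H where "bounded_clinear H" "\<And>x. H x + K (H x) = x" "\<And>x. H (x + K x) = x"
proof -
  let ?c = "onorm K"
  have bl: "bounded_linear K" using K by (simp add: bounded_clinear_def)
  note Kn = onorm[OF bl]
  have "\<exists>!x. y - K x = x" for y
  proof (rule banach_fix_type[OF onorm_pos_le[OF bl] less], intro allI)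
    fix x z
    show "dist (y - K x) (y - K z) \<le> ?c * dist x z"
      using Kn[of "x - z"] by (simp add: bounded_clinear_diff_apply[OF K] dist_norm norm_minus_commute)
  qed
  then have ex1: "\<exists>!x. x + K x = y" for y
    by (metis add_diff_cancel_right' diff_add_cancel)
  then obtain H where H: "\<And>y. H y + K (H y) = y" by metis
  have HI: "H y = x" if "x + K x = y" for x y using ex1[of y] H that by blast
  have add: "H (x + y) = H x + H y" for x y
  proof (rule HI)
    have "H x + H y + (K (H x) + K (H y)) = (H x + K (H x)) + (H y + K (H y))"
      by (simp add: algebra_simps)
    then show "H x + H y + K (H x + H y) = x + y" by (simp add: bounded_clinear_add_apply[OF K] H)
  qed
  have scale: "H (c *\<^sub>C x) = c *\<^sub>C H x" for c x
    using K by (intro HI) (simp add: bounded_clinear_def H flip: scaleC_add_right)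
  have "norm (H x) \<le> norm x * (1 / (1 - ?c))" for x
  proof -
    have "H x = x - K (H x)" using H[of x] by (simp add: eq_diff_eq)
    then have "norm (H x) \<le> norm x + norm (K (H x))" by (metis norm_triangle_ineq4)
    then have "norm (H x) * (1 - ?c) \<le> norm x" using Kn[of "H x"] by (simp add: algebra_simps)
    then show ?thesis using less by (simp add: field_simps)
  qed
  then have "bounded_linear H"
    by (intro bounded_linear_intro[of H "1 / (1 - ?c)"]) (auto simp: add scale scaleR_scaleC)
  with scale have "bounded_clinear H" by (simp add: bounded_clinear_def)
  then show ?thesis using that H HI by blast
qed

text \<open>If \<open>H\<close> inverts \<open>I + GS\<close>, then \<open>I - SHG\<close> inverts
  \<open>I + SG\<close>. Thus a norm bound on \<open>GS\<close> alone makes both operators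
  invertible.\<close>

lemma id_plus_swap_inverse:
  assumes S: "bounded_clinear S" and G: "bounded_clinear G"
    and HF: "\<And>x. H (x + G (S x)) = x" and FH: "\<And>x. H x + G (S (H x)) = x"
  shows "(y - S (H (G y))) + S (G (y - S (H (G y)))) = y"
    and "(y + S (G y)) - S (H (G (y + S (G y)))) = y"
proof -
  have "S (H (G y)) + S (G (S (H (G y)))) = S (G y)"
    by (simp add: FH flip: bounded_clinear_add_apply[OF S])
  then show "(y - S (H (G y))) + S (G (y - S (H (G y)))) = y"
    by (simp add: bounded_clinear_diff_apply[OF S] bounded_clinear_diff_apply[OF G] algebra_simps)
  show "(y + S (G y)) - S (H (G (y + S (G y)))) = y"
    by (simp add: bounded_clinear_add_apply[OF G] HF)
qed

lemma op_inverse_total_op: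
  assumes "\<And>x. g (f x) = x" "\<And>y. f (g y) = y"
  shows "op_inverse (total_op f) = total_op g"
proof
  fix y
  have "total_op f x = Some y \<longleftrightarrow> x = g y" for x using assms by auto
  then show "op_inverse (total_op f) y = total_op g y" by (simp add: op_inverse_def)
qed

lemma boundedly_invertible_total_op:
  assumes "bounded_clinear f" "bounded_clinear g" "\<And>x. g (f x) = x" "\<And>y. f (g y) = y"
  shows "boundedly_invertible (total_op f)"
proof -
  have "f \<circ> g = id" "g \<circ> f = id" using assms(3,4) by (simp_all add: fun_eq_iff)
  with assms(1,2) show ?thesis unfolding boundedly_invertible_def by blast
qed

section \<open>The Moore-Penrose inverse of the perturbed operator\<close>

theorem theorem3p5:
  fixes T :: "'a::chilbert_space \<rightharpoonup> 'b::chilbert_space"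
    and S :: "'a \<Rightarrow> 'b"
  assumes "\<forall>B :: 'a set. finite B \<longrightarrow> cspan B \<noteq> UNIV"
    and "\<forall>B :: 'b set. finite B \<longrightarrow> cspan B \<noteq> UNIV"
    and "linear_op T" and "densely_defined T" and "closed_op T"
    and "closed (ran T)"
    and "bounded_clinear S"
    and "onorm (\<lambda>x. the ((T\<^sup>\<dagger> \<circ>\<^sub>m total_op S) x)) < 1"
    and "T \<circ>\<^sub>m T\<^sup>\<dagger> \<circ>\<^sub>m total_op S = total_op S"
    and "total_op S \<circ>\<^sub>m T\<^sup>\<dagger> \<circ>\<^sub>m T = total_op S |` dom T"
  shows "closed (ran (T \<oplus> total_op S))
    \<and> boundedly_invertible (Some \<oplus> (T\<^sup>\<dagger> \<circ>\<^sub>m total_op S))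
    \<and> boundedly_invertible (Some \<oplus> (total_op S \<circ>\<^sub>m T\<^sup>\<dagger>))
    \<and> (T \<oplus> total_op S)\<^sup>\<dagger> = op_inverse (Some \<oplus> (T\<^sup>\<dagger> \<circ>\<^sub>m total_op S)) \<circ>\<^sub>m T\<^sup>\<dagger>
    \<and> (T \<oplus> total_op S)\<^sup>\<dagger> = T\<^sup>\<dagger> \<circ>\<^sub>m op_inverse (Some \<oplus> (total_op S \<circ>\<^sub>m T\<^sup>\<dagger>))
    \<and> T\<^sup>\<dagger> = (T \<oplus> total_op S)\<^sup>\<dagger> \<circ>\<^sub>m (Some \<oplus> (total_op S \<circ>\<^sub>m T\<^sup>\<dagger>))"
proof -
  note T = assms(3,5,6) and S = assms(7)
  obtain G where G: "bounded_clinear G" and mpG: "is_mp_inverse T (total_op G)"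
    by (rule mp_inverse_exists[OF T])
  have Td: "T\<^sup>\<dagger> = total_op G" by (rule mp_inverse_eqI[OF T(1) mpG])
  define P where "P = ortho_proj (ran T)"
  note R = csubspace_ran[OF T(1)]
  have TG: "T (G y) = Some (P y)"
    and GT: "T x = Some u \<Longrightarrow> G u = ortho_proj (ortho_compl (null_space T)) x"
    and G0: "G y = 0 \<longleftrightarrow> y \<in> ortho_compl (ran T)" for x y u
    using is_mp_inverse_total_op_iff[OF T(1,3) G, THEN iffD1, OF mpG]
    by (auto simp: P_def dom_def)
  note prP = ortho_proj_props[OF R T(3), folded P_def]
  note G_lin = bounded_clinear_add_apply[OF G] bounded_clinear_diff_apply[OF G]
    and S_lin = bounded_clinear_add_apply[OF S] bounded_clinear_diff_apply[OF S]
  \<comment> \<open>The difference \<open>y - P y\<close> is orthogonal to the range of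
    \<open>T\<close>, which is exactly where \<open>G\<close> vanishes.\<close>
  have GP: "G (P y) = G y" for y using prP(2)[of y] by (simp add: G0[symmetric] G_lin)
  \<comment> \<open>Hypothesis (2) serves to place the range of \<open>S\<close> inside that of
    \<open>T\<close>.\<close>
  have "T (G (S x)) = Some (S x)" for x
    using fun_cong[OF assms(9)[unfolded Td], of x] by simp
  then have S_ran: "S x \<in> ran T" for x by (metis ranI)
  have SGT: "S (G u) = S x" if "T x = Some u" for x u
    using fun_cong[OF assms(10)[unfolded Td], of x] that by (simp add: map_comp_def restrict_map_def domI)
  have "onorm (\<lambda>x. G (S x)) < 1" using assms(8) by (simp add: Td)
  then obtain H where H: "bounded_clinear H"
      "\<And>x. H x + G (S (H x)) = x" "\<And>x. H (x + G (S x)) = x"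
    using id_plus_contraction_inverse[OF bounded_clinear_compose[OF G S]] by metis
  define E where "E x = x + G (S x)" for x
  define F where "F y = y + S (G y)" for y
  define H' where "H' y = y - S (H (G y))" for y
  have EH: "E (H x) = x" and HE: "H (E x) = x" for x by (simp_all add: E_def H)
  have FH': "F (H' y) = y" and H'F: "H' (F y) = y" for y
    unfolding F_def H'_def by (rule id_plus_swap_inverse[OF S G H(3,2)])+
  have E: "bounded_clinear E" and F: "bounded_clinear F" and H': "bounded_clinear H'"
    unfolding E_def[abs_def] F_def[abs_def] H'_def[abs_def]
    by (intro bounded_clinear_add bounded_clinear_diff bounded_clinear_ident
        bounded_clinear_compose[OF G S] bounded_clinear_compose[OF S G]
        bounded_clinear_compose[OF S bounded_clinear_compose[OF H(1) G]])+
  \<comment> \<open>The intertwining \<open>G F = E G\<close> passes to the inverses; this makes the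
    two formulas for the perturbed Moore-Penrose inverse agree.\<close>
  have HG: "H (G y) = G (H' y)" for y
  proof -
    have "G y = G (F (H' y))" by (simp add: FH')
    also have "\<dots> = E (G (H' y))" by (simp add: E_def F_def G_lin)
    finally show ?thesis by (simp add: HE)
  qed
  have E_op: "Some \<oplus> (total_op G \<circ>\<^sub>m total_op S) = total_op E"
    by (auto simp: op_plus_def E_def dom_def fun_eq_iff)
  have F_op: "Some \<oplus> (total_op S \<circ>\<^sub>m total_op G) = total_op F"
    by (auto simp: op_plus_def F_def dom_def fun_eq_iff)

  define U where "U = T \<oplus> total_op S"
  \<comment> \<open>By hypothesis (3), \<open>S x\<close> equals \<open>S (G (T x))\<close> on the
    domain of \<open>T\<close>, so the perturbation acts after \<open>T\<close> as the bijection
    \<open>F\<close>.\<close>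
  have U: "U x = map_option F (T x)" for x
    by (auto simp: U_def op_plus_def F_def SGT domIff split: option.split)
  \<comment> \<open>\<open>F y\<close> and \<open>y\<close> differ by a value of \<open>S\<close>,
    which lies in the range of \<open>T\<close>.\<close>
  have F_ran: "F y \<in> ran T \<longleftrightarrow> y \<in> ran T" for y
    using complex_vector.subspace_add[OF R _ S_ran, of y "G y"]
      complex_vector.subspace_diff[OF R _ S_ran, of "F y" "G y"] by (auto simp: F_def)
  have "U = (\<lambda>x. map_option F (T x))" by (simp add: U fun_eq_iff)
  then have "ran U = F ` ran T" by (simp add: ran_map_option)
  also have "\<dots> = ran T"
  proof (intro subset_antisym subsetI)
    fix y assume "y \<in> ran T"
    then have "H' y \<in> ran T" using F_ran[of "H' y"] by (simp add: FH')
    then show "y \<in> F ` ran T" by (rule rev_image_eqI) (simp add: FH')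
  qed (auto simp: F_ran)
  finally have ran_U: "ran U = ran T" .
  have F0: "F y = 0 \<longleftrightarrow> y = 0" for y
    using H'F[of y] H'F[of 0] bounded_clinear_diff_apply[OF F, of 0 0] by auto
  have null_U: "null_space U = null_space T" by (auto simp: null_space_def U F0)
  have lin_U: "linear_op U"
  proof (rule linear_opI)
    have "dom U = dom T" by (auto simp: U dom_def)
    then show "csubspace (dom U)" using T(1) by (simp add: linear_op_def)
  next
    fix x y u v assume "U x = Some u" "U y = Some v"
    then obtain u' v' where uv: "T x = Some u'" "u = F u'" "T y = Some v'" "v = F v'"
      by (auto simp: U)
    then show "U (x + y) = Some (u + v)"
      using linear_op_add[OF T(1) uv(1,3)] by (simp add: U bounded_clinear_add_apply[OF F])
  next
    fix c x u assume "U x = Some u"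
    then obtain u' where u: "T x = Some u'" "u = F u'" by (auto simp: U)
    then show "U (c *\<^sub>C x) = Some (c *\<^sub>C u)"
      using linear_op_scaleC[OF T(1) u(1), of c] F by (simp add: U bounded_clinear_def)
  qed
  have F_P: "F (P y) = P (F y)" for y
  proof -
    \<comment> \<open>The terms with \<open>S\<close> cancel by \<open>GP\<close>, so
      \<open>F (P y)\<close> lies in the range and differs from \<open>F y\<close> by a vector
      orthogonal to it.\<close>
    have "F y - F (P y) = y - P y" by (simp add: F_def GP)
    then show ?thesis
      unfolding P_def using prP[of y, unfolded P_def]
      by (intro ortho_proj_eqI[OF R, symmetric]) (simp_all add: F_ran)
  qed
  let ?X = "\<lambda>y. G (H' y)"
  have X: "bounded_clinear ?X" by (rule bounded_clinear_compose[OF G H'])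
  have "is_mp_inverse U (total_op ?X)"
  proof (subst is_mp_inverse_total_op_iff[OF lin_U _ X], unfold ran_U null_U, intro T(3),
      intro conjI allI ballI)
    fix y
    show "U (?X y) = Some (ortho_proj (ran T) y)" by (simp add: U TG F_P FH' flip: P_def)
  next
    fix x assume "x \<in> dom U"
    then obtain u where u: "T x = Some u" by (auto simp: U)
    then show "?X (the (U x)) = ortho_proj (ortho_compl (null_space T)) x"
      using GT[OF u] by (simp add: U H'F)
  next
    \<comment> \<open>\<open>F\<close> fixes every vector that \<open>G\<close> annihilates, because
      \<open>S 0 = 0\<close>. This applies to \<open>y\<close> in one direction and to
      \<open>H' y\<close> in the other.\<close>
    have "?X y = 0 \<longleftrightarrow> G y = 0" for y
    proof
      assume "G y = 0"
      then have "F y = y" using bounded_clinear_diff_apply[OF S, of 0 0] by (simp add: F_def)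
      with \<open>G y = 0\<close> show "?X y = 0" using H'F[of y] by simp
    next
      assume 0: "?X y = 0"
      then have "F (H' y) = H' y" using bounded_clinear_diff_apply[OF S, of 0 0] by (simp add: F_def)
      with 0 show "G y = 0" by (simp add: FH')
    qed
    then show "{y. ?X y = 0} = ortho_compl (ran T)" by (auto simp: G0)
  qed
  then have Ud: "U\<^sup>\<dagger> = total_op ?X" by (rule mp_inverse_eqI[OF lin_U])
  show ?thesis
    unfolding U_def[symmetric] E_op F_op Ud Td
      op_inverse_total_op[OF HE EH] op_inverse_total_op[OF H'F FH'] ran_U
    using T(3) boundedly_invertible_total_op[OF E H(1) HE EH]
      boundedly_invertible_total_op[OF F H' H'F FH']
    by (simp add: fun_eq_iff HG H'F)
qed

end
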